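(* Let $r\ge 1$ be an integer. There is a constant $c_r$ depending only on $r$ such that the following holds. Let $(X,\mu)$ be a measure space and let $\{f_n\}_{n\in I}$ be a finite collection of complex-valued functions in $L^{2r}(X,\mu)$ satisfying the Type II condition: for every $2r$-tuple $(n_1,\dots,n_{2r})\in I^{2r}$ in which some value appears precisely once, $$\int_X f_{n_1}\overline{f_{n_2}}\cdots f_{n_{2r-1}}\overline{f_{n_{2r}}}\,d\mu=0 .$$ Then $$\Big\|\sum_{n\in I} f_n\Big\|_{L^{2r}(X,\mu)}\le c_r\,\Big\|\Big(\sum_{n\in I} |f_n|^2\Big)^{1/2}\Big\|_{L^{2r}(X,\mu)} .$$ In particular $c_r$ does not depend on the cardinality of $I$.
   Context: A value $v$ appears precisely once in a tuple $(n_1,\dots,n_{2r})$ if there is exactly one position $j$ with $n_j=v$. *)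

theory Defs
  imports "HOL-Analysis.Analysis"
begin

definition Lp_space :: "real \<Rightarrow> 'a measure \<Rightarrow> ('a \<Rightarrow> 'b::{banach, second_countable_topology}) set" where
  "Lp_space p M = {f \<in> borel_measurable M. integrable M (\<lambda>x. norm (f x) powr p)}"

(* The Bochner integral has value 0 for a non-integrable integrand, so this is the
   usual norm only for elements of Lp_space p M with p > 0.  It is applied below
   only to such functions. *)
definition Lp_norm :: "real \<Rightarrow> 'a measure \<Rightarrow> ('a \<Rightarrow> 'b::{banach, second_countable_topology}) \<Rightarrow> real" where
  "Lp_norm p M f = (\<integral>x. norm (f x) powr p \<partial>M) powr (1 / p)"

(* A 2r-tuple (n_1, ..., n_{2r}) of elements of I is a function in {1..2*r} \<rightarrow>\<^sub>E I. *)
definition appears_once :: "nat \<Rightarrow> (nat \<Rightarrow> 'i) \<Rightarrow> 'i \<Rightarrow> bool" where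
  "appears_once m n v \<longleftrightarrow> (\<exists>!j. j \<in> {1..m} \<and> n j = v)"

(* For f n in L^(2r) every integrand below is integrable (Hoelder), so no integral
   vanishes merely by convention. *)
definition type_II :: "nat \<Rightarrow> 'a measure \<Rightarrow> 'i set \<Rightarrow> ('i \<Rightarrow> 'a \<Rightarrow> complex) \<Rightarrow> bool" where
  "type_II r M I f \<longleftrightarrow>
     (\<forall>n \<in> {1..2*r} \<rightarrow>\<^sub>E I. (\<exists>v. appears_once (2*r) n v) \<longrightarrow>
        (\<integral>x. (\<Prod>j=1..r. f (n (2*j - 1)) x * cnj (f (n (2*j)) x)) \<partial>M) = 0)"

definition square_function :: "'i set \<Rightarrow> ('i \<Rightarrow> 'a \<Rightarrow> complex) \<Rightarrow> 'a \<Rightarrow> real" where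
  "square_function I f x = sqrt (\<Sum>n\<in>I. (cmod (f n x))\<^sup>2)"

(* HOL cannot quantify over types inside a formula: in a theorem of the form
   "\<exists>c. \<forall>(M :: 'a measure) (I :: 'i set) f. ..." the number c could depend on the types
   'a and 'i (hence, for a finite type 'i, on a bound for the cardinality of I).  To have
   a constant depending on r alone, c_r is chosen once and for all, as some number that
   is admissible for all finite collections, indexed by natural numbers, over measure
   spaces on the one type nat \<Rightarrow> complex.  The choice operator by itself gives no
   information about this number: that an admissible number exists, and that the
   chosen one serves all measure spaces and index sets of all types, is left
   to the theorem. *)
definition square_function_const :: "nat \<Rightarrow> real" where
  "square_function_const r =
     (SOME c. \<forall>(M :: (nat \<Rightarrow> complex) measure) (I :: nat set) f.
        finite I \<longrightarrow> (\<forall>n\<in>I. f n \<in> Lp_space (2 * real r) M) \<longrightarrow> type_II r M I f \<longrightarrow>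
        Lp_norm (2 * real r) M (\<lambda>x. \<Sum>n\<in>I. f n x)
          \<le> c * Lp_norm (2 * real r) M (square_function I f))"

end

theory Submission
  imports Defs
begin

text \<open>
  Expanding \<open>|\<Sum> f n|^(2r)\<close> and integrating, only the tuples in which every value is repeated
  survive. Group these by their coincidence pattern: a pattern with block sizes \<open>k\<^sub>1, \<dots>, k\<^sub>s \<ge> 2\<close>
  contributes pointwise at most the product of the sums \<open>\<Sum>n. |f n|^(k\<^sub>i)\<close>, and each of these is at most
  \<open>Q^(k\<^sub>i)\<close>, where \<open>Q\<close> is the square function. There are at most \<open>(2r)^(2r)\<close> patterns.

  The measure may be replaced by the joint distribution of the functions, which lives
  on \<open>nat \<Rightarrow> complex\<close>; hence the constant chosen there serves all measure spaces.
\<close>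

section \<open>Pointwise inequalities for nonnegative reals\<close>

lemma powr_real_eq_power:
  fixes x :: real
  assumes "x \<ge> 0" "n > 0"
  shows "x powr real n = x ^ n"
  using assms by (cases "x = 0") (auto simp: powr_realpow)

text \<open>Each \<open>a v\<close> is at most the root \<open>Q\<close> of the sum of squares, so
  all but two factors of \<open>a v ^ k\<close> can be replaced by \<open>Q\<close>; the remaining
  squares sum to \<open>Q\<^sup>2\<close>.\<close>

lemma sum_power_le_sqrt_power:
  fixes a :: "'i \<Rightarrow> real"
  assumes "finite I" "\<And>v. a v \<ge> 0" "k \<ge> 2"
  shows "(\<Sum>v\<in>I. a v ^ k) \<le> sqrt (\<Sum>v\<in>I. (a v)\<^sup>2) ^ k"
proof -
  define Q where "Q = sqrt (\<Sum>v\<in>I. (a v)\<^sup>2)"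
  obtain l where k: "k = l + 2"
    using assms(3) le_Suc_ex by (metis add.commute)
  have Q2: "Q\<^sup>2 = (\<Sum>v\<in>I. (a v)\<^sup>2)"
    unfolding Q_def by (simp add: sum_nonneg)
  have le: "a v \<le> Q" if "v \<in> I" for v
    unfolding Q_def
    by (rule real_le_rsqrt) (use that assms(1) in \<open>auto intro: member_le_sum\<close>)
  have "(\<Sum>v\<in>I. a v ^ k) \<le> (\<Sum>v\<in>I. Q ^ l * (a v)\<^sup>2)"
    unfolding k power_add
    by (intro sum_mono mult_right_mono power_mono le assms) auto
  also have "\<dots> = Q ^ k"
    by (simp only: k power_add Q2 sum_distrib_left)
  finally show ?thesis unfolding Q_def .
qed

text \<open>A tuple on the left factors as \<open>g \<circ> p\<close>, where \<open>p\<close>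
  records which positions coincide and \<open>g\<close> gives each block its value. Allowing
  \<open>g\<close> to repeat values only adds nonnegative terms, and it makes the sum over
  \<open>g\<close> factor over the blocks.\<close>

lemma sum_repeated_le_square_sum:
  fixes a :: "'i \<Rightarrow> real" and m :: nat
  assumes I: "finite I" and a: "\<And>v. a v \<ge> 0"
  shows "(\<Sum>n \<in> {n \<in> {1..m} \<rightarrow>\<^sub>E I. \<nexists>v. appears_once m n v}. \<Prod>j=1..m. a (n j))
          \<le> real (m ^ m) * sqrt (\<Sum>v\<in>I. (a v)\<^sup>2) ^ m"
    (is "sum ?F ?A \<le> _")
proof -
  define Q where "Q = sqrt (\<Sum>v\<in>I. (a v)\<^sup>2)"
  have Q0: "Q \<ge> 0" unfolding Q_def by (simp add: sum_nonneg)
  define N where "N = {1..m}"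
  have finN: "finite N" by (simp add: N_def)
  define fib where "fib p i = {j \<in> N. p j = i}" for p :: "nat \<Rightarrow> nat" and i
  \<comment> \<open>Several \<open>p\<close> may induce the same partition of the positions; this
    overcounting is harmless in an upper bound.\<close>
  define P where "P = {p \<in> N \<rightarrow>\<^sub>E N. \<forall>i \<in> p ` N. card (fib p i) \<ge> 2}"
  have finP: "finite P"
    unfolding P_def by (rule finite_subset[of _ "N \<rightarrow>\<^sub>E N"]) (auto simp: finN finite_PiE)
  have fibre_sum: "(\<Sum>g \<in> p ` N \<rightarrow>\<^sub>E I. \<Prod>j\<in>N. a (g (p j))) \<le> Q ^ m" if "p \<in> P" for p
  proof -
    have "(\<Prod>j\<in>N. a (g (p j))) = (\<Prod>i\<in>p ` N. a (g i) ^ card (fib p i))" for g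
    proof -
      have "(\<Prod>j\<in>N. a (g (p j))) = (\<Prod>i\<in>p ` N. \<Prod>j | j \<in> N \<and> p j = i. a (g (p j)))"
        by (rule prod.image_gen[OF finN])
      also have "\<dots> = (\<Prod>i\<in>p ` N. a (g i) ^ card (fib p i))"
        by (intro prod.cong refl) (simp add: fib_def)
      finally show ?thesis .
    qed
    \<comment> \<open>The values of \<open>g\<close> on the image of \<open>p\<close> are chosen
      independently, so the sum of products becomes a product of power sums, each with exponent at
      least 2.\<close>
    then have "(\<Sum>g \<in> p ` N \<rightarrow>\<^sub>E I. \<Prod>j\<in>N. a (g (p j)))
        = (\<Prod>i\<in>p ` N. \<Sum>v\<in>I. a v ^ card (fib p i))"
      using finN I by (simp add: prod_sum_PiE)
    also have "\<dots> \<le> (\<Prod>i\<in>p ` N. Q ^ card (fib p i))"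
      unfolding Q_def using that
      by (intro prod_mono conjI sum_nonneg sum_power_le_sqrt_power I)
        (auto simp: a P_def)
    also have "\<dots> = Q ^ (\<Sum>i\<in>p ` N. card (fib p i))"
      by (simp add: power_sum)
    also have "(\<Sum>i\<in>p ` N. card (fib p i)) = m"
      using sum.image_gen[OF finN, of "\<lambda>_. 1::nat" p] by (simp add: fib_def N_def)
    finally show ?thesis .
  qed
  have "sum ?F ?A \<le> (\<Sum>(p, g) \<in> Sigma P (\<lambda>p. p ` N \<rightarrow>\<^sub>E I). \<Prod>j\<in>N. a (g (p j)))"
  \<comment> \<open>It suffices to find, for each tuple, one pair \<open>(p, g)\<close> composing to
    it with at least the same summand; distinct tuples use distinct pairs, and the other pairs
    contribute nonnegative terms.\<close>
  proof (rule sum_le_included[where i = "\<lambda>(p, g). restrict (g \<circ> p) N"])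
    show "finite ?A"
      by (rule finite_subset[of _ "{1..m} \<rightarrow>\<^sub>E I"]) (auto simp: I finite_PiE)
    show "finite (Sigma P (\<lambda>p. p ` N \<rightarrow>\<^sub>E I))"
      using finP finN I by (intro finite_SigmaI finite_PiE) auto
    show "\<forall>y \<in> Sigma P (\<lambda>p. p ` N \<rightarrow>\<^sub>E I). 0 \<le> (case y of (p, g) \<Rightarrow> \<Prod>j\<in>N. a (g (p j)))"
      by (auto intro!: prod_nonneg a)
    show "\<forall>n\<in>?A. \<exists>y\<in>Sigma P (\<lambda>p. p ` N \<rightarrow>\<^sub>E I).
        (case y of (p, g) \<Rightarrow> restrict (g \<circ> p) N) = n
        \<and> ?F n \<le> (case y of (p, g) \<Rightarrow> \<Prod>j\<in>N. a (g (p j)))"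
    proof
      fix n assume n: "n \<in> ?A"
      \<comment> \<open>\<open>p\<close> encodes the coincidence pattern of \<open>n\<close>: it sends a position to the first one with the same value.\<close>
      define p where "p = (\<lambda>j\<in>N. LEAST i. i \<in> N \<and> n i = n j)"
      have p: "p j \<in> N \<and> n (p j) = n j" if "j \<in> N" for j
        using LeastI[of "\<lambda>i. i \<in> N \<and> n i = n j" j] that by (simp add: p_def)
      \<comment> \<open>The least position depends on \<open>j\<close> only through the value
        \<open>n j\<close>.\<close>
      have p_eq: "p i = p j" if "i \<in> N" "j \<in> N" "n i = n j" for i j
        using that by (simp add: p_def)
      have "card (fib p i) \<ge> 2" if i: "i \<in> p ` N" for i
      proof -
        obtain j where j: "j \<in> N" "i = p j" using i by auto
        \<comment> \<open>The value \<open>n j\<close> is not isolated, so a second position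
          \<open>k\<close> carries it and falls into the same fibre of \<open>p\<close>.\<close>
        have "\<not> (\<exists>!k. k \<in> N \<and> n k = n j)"
          using n unfolding appears_once_def N_def by blast
        then obtain k where k: "k \<in> N" "n k = n j" "k \<noteq> j"
          using ex1I[of "\<lambda>k. k \<in> N \<and> n k = n j" j] j(1) by blast
        have "{j, k} \<subseteq> fib p i"
          using j k p_eq[of k j] by (auto simp: fib_def)
        moreover have "finite (fib p i)" by (simp add: fib_def finN)
        ultimately have "card {j, k} \<le> card (fib p i)" by (rule card_mono[rotated])
        then show ?thesis using k by auto
      qed
      then have pP: "p \<in> P" using p by (auto simp: P_def p_def)
      have nPi: "n \<in> N \<rightarrow>\<^sub>E I" using n by (auto simp: N_def)
      \<comment> \<open>The image of \<open>p\<close> consists of one representative per block, so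
        \<open>n\<close> itself supplies the block values.\<close>
      define g where "g = restrict n (p ` N)"
      have "g \<in> p ` N \<rightarrow>\<^sub>E I"
        using p PiE_mem[OF nPi] unfolding g_def by (intro PiE_I) auto
      moreover have gp: "g (p j) = n j" if "j \<in> N" for j
        using p that by (simp add: g_def)
      moreover have "restrict (g \<circ> p) N = n"
        by (rule extensionalityI[of _ N]) (use gp nPi in \<open>auto simp: PiE_iff\<close>)
      moreover have "?F n = (\<Prod>j\<in>N. a (g (p j)))"
        unfolding N_def[symmetric] by (intro prod.cong) (simp_all add: gp)
      ultimately show "\<exists>y\<in>Sigma P (\<lambda>p. p ` N \<rightarrow>\<^sub>E I).
        (case y of (p, g) \<Rightarrow> restrict (g \<circ> p) N) = n
        \<and> ?F n \<le> (case y of (p, g) \<Rightarrow> \<Prod>j\<in>N. a (g (p j)))"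
        using pP by (intro bexI[of _ "(p, g)"]) auto
    qed
  qed
  also have "\<dots> = (\<Sum>p\<in>P. \<Sum>g \<in> p ` N \<rightarrow>\<^sub>E I. \<Prod>j\<in>N. a (g (p j)))"
    using finP finN I by (subst sum.Sigma) (auto intro: finite_PiE)
  also have "\<dots> \<le> (\<Sum>p\<in>P. Q ^ m)"
    by (intro sum_mono fibre_sum)
  also have "\<dots> = real (card P) * Q ^ m" by simp
  also have "\<dots> \<le> real (m ^ m) * Q ^ m"
  proof -
    \<comment> \<open>Patterns are bounded crudely by all self-maps of the positions.\<close>
    have "card P \<le> card (N \<rightarrow>\<^sub>E N)"
      by (rule card_mono) (auto simp: P_def finN finite_PiE)
    also have "\<dots> = m ^ m" by (simp add: card_PiE N_def)
    finally show ?thesis using Q0 by (intro mult_right_mono) auto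
  qed
  finally show ?thesis unfolding Q_def .
qed

text \<open>The product is at most the \<open>m\<close>-th power of its largest factor, which is one
  term of the sum. This stands in for Hoelder's inequality when the products have to be dominated by
  an integrable function.\<close>

lemma prod_le_sum_power:
  fixes a :: "'i \<Rightarrow> real"
  assumes "finite I" "\<And>v. a v \<ge> 0" "n \<in> {1..m} \<rightarrow> I" "m > 0"
  shows "(\<Prod>j=1..m. a (n j)) \<le> (\<Sum>v\<in>I. a v ^ m)"
proof -
  have "finite (a ` n ` {1..m})" "a ` n ` {1..m} \<noteq> {}" using assms by auto
  then obtain v where v: "v \<in> n ` {1..m}" "a v = Max (a ` n ` {1..m})"
    using Max_in by (smt (verit) imageE)
  have "(\<Prod>j=1..m. a (n j)) \<le> (\<Prod>j=1..m. a v)"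
    unfolding v by (intro prod_mono conjI Max_ge assms) auto
  also have "\<dots> = a v ^ m" by simp
  also have "\<dots> \<le> (\<Sum>v\<in>I. a v ^ m)"
    by (rule member_le_sum) (use assms v in auto)
  finally show ?thesis .
qed

section \<open>Alternating conjugates and even exponents\<close>

text \<open>Positions are counted from 1, so the conjugated factors of the type II product sit at
  the even ones. The product over pairs thus becomes one product over all positions, to which the
  distributive law applies.\<close>

definition cnj_even :: "nat \<Rightarrow> complex \<Rightarrow> complex" where
  "cnj_even j z = (if even j then cnj z else z)"

lemma norm_cnj_even [simp]: "norm (cnj_even j z) = norm z"
  by (simp add: cnj_even_def)

lemma cnj_even_sum: "cnj_even j (\<Sum>v\<in>I. g v) = (\<Sum>v\<in>I. cnj_even j (g v))"
  by (simp add: cnj_even_def)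

lemma borel_measurable_cnj [measurable]: "cnj \<in> borel_measurable borel"
  by (intro borel_measurable_continuous_onI continuous_intros)

lemma borel_measurable_cnj_even:
  assumes [measurable]: "g \<in> borel_measurable M"
  shows "(\<lambda>x. cnj_even j (g x)) \<in> borel_measurable M"
  by (cases "even j") (simp_all add: cnj_even_def)

lemma prod_cnj_pairs:
  "(\<Prod>j=1..r. z (2*j - 1) * cnj (z (2*j))) = (\<Prod>j=1..2*r. cnj_even j (z j))"
  by (induction r) (simp_all add: cnj_even_def mult.assoc)

lemma norm_power_eq_prod_cnj_even:
  "complex_of_real (norm z ^ (2*r)) = (\<Prod>j=1..2*r. cnj_even j z)"
  \<comment> \<open>For a constant tuple each of the \<open>r\<close> pairs contributes
    \<open>z * cnj z\<close>, the square of the norm.\<close>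
  unfolding prod_cnj_pairs[of "\<lambda>_. z", symmetric]
  by (simp only: power_mult of_real_power[of "(norm z)\<^sup>2"] complex_norm_square) simp

lemma Lp_space_even_iff:
  fixes g :: "'a \<Rightarrow> 'b::{banach, second_countable_topology}"
  assumes "r \<ge> 1"
  shows "g \<in> Lp_space (2 * real r) M \<longleftrightarrow>
    g \<in> borel_measurable M \<and> integrable M (\<lambda>x. norm (g x) ^ (2*r))"
  using powr_real_eq_power[of "norm (g _)" "2*r"] assms by (simp add: Lp_space_def)

lemma Lp_norm_even:
  fixes g :: "'a \<Rightarrow> 'b::{banach, second_countable_topology}"
  assumes "r \<ge> 1"
  shows "Lp_norm (2 * real r) M g = (\<integral>x. norm (g x) ^ (2*r) \<partial>M) powr (1 / (2 * real r))"
  using powr_real_eq_power[of "norm (g _)" "2*r"] assms by (simp add: Lp_norm_def)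

section \<open>The integrated inequality with an explicit constant\<close>

text \<open>Absolute values are taken only after the type II condition has removed the tuples
  outside \<open>A\<close>; the pointwise bound for repeated tuples then applies under the
  integral.\<close>

lemma integral_norm_sum_power_le:
  fixes f :: "'i \<Rightarrow> 'a \<Rightarrow> complex"
  assumes r: "r \<ge> 1" and I: "finite I"
    and f: "\<And>n. n \<in> I \<Longrightarrow> f n \<in> Lp_space (2 * real r) M"
    and II: "type_II r M I f"
  shows "(\<integral>x. norm (\<Sum>n\<in>I. f n x) ^ (2*r) \<partial>M)
    \<le> real ((2*r) ^ (2*r)) * (\<integral>x. norm (square_function I f x) ^ (2*r) \<partial>M)"
proof -
  define T where "T = {1..2*r} \<rightarrow>\<^sub>E I"
  define A where "A = {n \<in> T. \<nexists>v. appears_once (2*r) n v}"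
  define F where "F n x = (\<Prod>j=1..2*r. cnj_even j (f (n j) x))" for n x
  define G where "G n x = (\<Prod>j=1..2*r. cmod (f (n j) x))" for n x
  have finT: "finite T" by (simp add: T_def I finite_PiE)
  have AT: "A \<subseteq> T" by (auto simp: A_def)
  have meas: "f n \<in> borel_measurable M" and pow: "integrable M (\<lambda>x. cmod (f n x) ^ (2*r))"
    if "n \<in> I" for n
    using f[OF that] by (simp_all add: Lp_space_even_iff[OF r])
  have norm_meas: "(\<lambda>x. cmod (f n x)) \<in> borel_measurable M" if "n \<in> I" for n
    using measurable_compose[OF meas[OF that] borel_measurable_norm] .
  have T_in: "n j \<in> I" if "n \<in> T" "j \<in> {1..2*r}" for n j
    using that by (auto simp: T_def)
  \<comment> \<open>Integrability of every product is what permits exchanging sum and integral; the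
    2r-th powers of the functions dominate.\<close>
  have intG: "integrable M (G n)" if n: "n \<in> T" for n
  proof (rule Bochner_Integration.integrable_bound)
    show "integrable M (\<lambda>x. \<Sum>v\<in>I. cmod (f v x) ^ (2*r))"
      by (intro Bochner_Integration.integrable_sum pow)
    show "G n \<in> borel_measurable M"
      unfolding G_def
      using T_in[OF n] by (auto intro!: borel_measurable_prod norm_meas)
    have "G n x \<le> (\<Sum>v\<in>I. cmod (f v x) ^ (2*r))" for x
      unfolding G_def using n r by (intro prod_le_sum_power I) (auto simp: T_def)
    moreover have "G n x \<ge> 0" for x by (simp add: G_def prod_nonneg)
    ultimately show "AE x in M. norm (G n x) \<le> norm (\<Sum>v\<in>I. cmod (f v x) ^ (2*r))"
      by (auto simp: sum_nonneg)
  qed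
  have normF: "cmod (F n x) = G n x" for n x
    by (simp add: F_def G_def prod_norm[symmetric])
  have intF: "integrable M (F n)" if n: "n \<in> T" for n
  proof (rule Bochner_Integration.integrable_bound[OF intG[OF n]])
    show "F n \<in> borel_measurable M"
      unfolding F_def
      using T_in[OF n] by (auto intro!: borel_measurable_prod borel_measurable_cnj_even meas)
    show "AE x in M. norm (F n x) \<le> norm (G n x)"
      by (auto simp: normF[symmetric])
  qed
  have expand: "complex_of_real (norm (\<Sum>n\<in>I. f n x) ^ (2*r)) = (\<Sum>n\<in>T. F n x)" for x
    unfolding norm_power_eq_prod_cnj_even cnj_even_sum T_def F_def
    by (subst prod_sum_PiE) (auto simp: I)
  have vanish: "(\<integral>x. F n x \<partial>M) = 0" if "n \<in> T - A" for n
    using II that unfolding type_II_def A_def T_def F_def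
      prod_cnj_pairs[of "\<lambda>j. f (n j) x" for x, symmetric]
    by blast
  have "complex_of_real (\<integral>x. norm (\<Sum>n\<in>I. f n x) ^ (2*r) \<partial>M) = (\<integral>x. (\<Sum>n\<in>T. F n x) \<partial>M)"
    unfolding expand[symmetric] by (rule integral_complex_of_real[symmetric])
  also have "\<dots> = (\<Sum>n\<in>T. \<integral>x. F n x \<partial>M)"
    by (intro Bochner_Integration.integral_sum intF)
  also have "\<dots> = (\<Sum>n\<in>A. \<integral>x. F n x \<partial>M)"
    by (rule sum.mono_neutral_right[OF finT AT]) (auto simp: vanish)
  finally have eq: "complex_of_real (\<integral>x. norm (\<Sum>n\<in>I. f n x) ^ (2*r) \<partial>M) = (\<Sum>n\<in>A. \<integral>x. F n x \<partial>M)" .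
  \<comment> \<open>The complex sum equals a real number, which is at most its modulus.\<close>
  have "(\<integral>x. norm (\<Sum>n\<in>I. f n x) ^ (2*r) \<partial>M) \<le> cmod (\<Sum>n\<in>A. \<integral>x. F n x \<partial>M)"
    unfolding eq[symmetric] by simp
  also have "\<dots> \<le> (\<Sum>n\<in>A. \<integral>x. G n x \<partial>M)"
    by (rule sum_norm_le) (simp add: normF[symmetric])
  also have "\<dots> = (\<integral>x. (\<Sum>n\<in>A. G n x) \<partial>M)"
    using AT by (intro Bochner_Integration.integral_sum[symmetric] intG) auto
  also have "\<dots> \<le> (\<integral>x. real ((2*r) ^ (2*r)) * norm (square_function I f x) ^ (2*r) \<partial>M)"
  proof (rule integral_mono)
    show "integrable M (\<lambda>x. \<Sum>n\<in>A. G n x)"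
      using AT by (intro Bochner_Integration.integrable_sum intG) auto
    show "integrable M (\<lambda>x. real ((2*r) ^ (2*r)) * norm (square_function I f x) ^ (2*r))"
    \<comment> \<open>The l2 norm is at most the l1 norm, and the 2r-th power of the latter expands
      into the sum of \<open>G n\<close> over all tuples.\<close>
    proof (rule integrable_mult_right, rule Bochner_Integration.integrable_bound)
      show "integrable M (\<lambda>x. \<Sum>n\<in>T. G n x)"
        by (intro Bochner_Integration.integrable_sum intG)
      show "(\<lambda>x. norm (square_function I f x) ^ (2*r)) \<in> borel_measurable M"
        unfolding square_function_def real_norm_def
        by (intro borel_measurable_power borel_measurable_abs
            measurable_compose[OF _ borel_measurable_sqrt]
            borel_measurable_sum norm_meas)
      have "norm (square_function I f x) ^ (2*r) \<le> (\<Sum>v\<in>I. cmod (f v x)) ^ (2*r)" for x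
      proof (rule power_mono)
        show "norm (square_function I f x) \<le> (\<Sum>v\<in>I. cmod (f v x))"
          using L2_set_le_sum[of I "\<lambda>v. cmod (f v x)"]
          by (simp add: square_function_def L2_set_def sum_nonneg)
      qed simp
      also have "(\<Sum>v\<in>I. cmod (f v x)) ^ (2*r) = (\<Sum>n\<in>T. G n x)" for x
        using prod_sum_PiE[of "{1..2*r}" "\<lambda>_. I" "\<lambda>_ v. cmod (f v x)"] I
        by (simp add: T_def G_def)
      finally show "AE x in M. norm (norm (square_function I f x) ^ (2*r)) \<le> norm (\<Sum>n\<in>T. G n x)"
        by (auto intro: order.trans[OF _ abs_ge_self])
    qed
    show "(\<Sum>n\<in>A. G n x) \<le> real ((2*r) ^ (2*r)) * norm (square_function I f x) ^ (2*r)" for x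
      using sum_repeated_le_square_sum[OF I, of "\<lambda>v. cmod (f v x)" "2*r"]
      by (simp add: A_def T_def G_def square_function_def sum_nonneg)
  qed
  finally show ?thesis by simp
qed

text \<open>The 2r-th root turns the factor \<open>(2*r) ^ (2*r)\<close> into \<open>2*r\<close>.
  This value depends on \<open>r\<close> alone, so it witnesses that
  \<open>square_function_const\<close> chooses among existing candidates.\<close>

lemma Lp_norm_sum_le_square_function:
  fixes f :: "'i \<Rightarrow> 'a \<Rightarrow> complex"
  assumes r: "r \<ge> 1" and I: "finite I"
    and f: "\<And>n. n \<in> I \<Longrightarrow> f n \<in> Lp_space (2 * real r) M"
    and II: "type_II r M I f"
  shows "Lp_norm (2 * real r) M (\<lambda>x. \<Sum>n\<in>I. f n x)
           \<le> real (2*r) * Lp_norm (2 * real r) M (square_function I f)"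
proof -
  let ?J = "\<integral>x. norm (square_function I f x) ^ (2*r) \<partial>M"
  have "Lp_norm (2 * real r) M (\<lambda>x. \<Sum>n\<in>I. f n x)
      \<le> (real ((2*r) ^ (2*r)) * ?J) powr (1 / (2 * real r))"
    unfolding Lp_norm_even[OF r]
    by (intro powr_mono2 integral_norm_sum_power_le assms) auto
  also have "\<dots> = real ((2*r) ^ (2*r)) powr (1 / (2 * real r)) * ?J powr (1 / (2 * real r))"
    by (rule powr_mult)
  also have "real ((2*r) ^ (2*r)) = real (2*r) powr real (2*r)"
    using r by (subst powr_real_eq_power) auto
  also have "\<dots> powr (1 / (2 * real r)) = real (2*r)"
    using r by (simp add: powr_powr)
  finally show ?thesis unfolding Lp_norm_even[OF r] .
qed

section \<open>Transfer of the chosen constant to all spaces and index sets\<close>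

lemma square_function_const:
  fixes M :: "(nat \<Rightarrow> complex) measure" and I :: "nat set"
  assumes "r \<ge> 1" "finite I" "\<And>n. n \<in> I \<Longrightarrow> f n \<in> Lp_space (2 * real r) M" "type_II r M I f"
  shows "Lp_norm (2 * real r) M (\<lambda>x. \<Sum>n\<in>I. f n x)
           \<le> square_function_const r * Lp_norm (2 * real r) M (square_function I f)"
proof -
  have "\<exists>c. \<forall>(M :: (nat \<Rightarrow> complex) measure) (I :: nat set) f.
        finite I \<longrightarrow> (\<forall>n\<in>I. f n \<in> Lp_space (2 * real r) M) \<longrightarrow> type_II r M I f \<longrightarrow>
        Lp_norm (2 * real r) M (\<lambda>x. \<Sum>n\<in>I. f n x)
          \<le> c * Lp_norm (2 * real r) M (square_function I f)"
    using Lp_norm_sum_le_square_function[OF assms(1)] by blast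
  from someI_ex[OF this] show ?thesis
    unfolding square_function_const_def using assms by blast
qed

text \<open>The bound with \<open>2*r\<close> does not settle this, since the chosen number might be
  smaller. Its defining property concerns one type of space only, so the inequality is pulled back
  from there.\<close>

theorem mainTheorem2:
  fixes r :: nat and M :: "'a measure" and I :: "'i set" and f :: "'i \<Rightarrow> 'a \<Rightarrow> complex"
  assumes "r \<ge> 1"
    and "finite I"
    and "\<And>n. n \<in> I \<Longrightarrow> f n \<in> Lp_space (2 * real r) M"
    and "type_II r M I f"
  shows "Lp_norm (2 * real r) M (\<lambda>x. \<Sum>n\<in>I. f n x)
           \<le> square_function_const r * Lp_norm (2 * real r) M (square_function I f)"
proof -
  note r = assms(1)
  obtain e where e: "bij_betw e {..<card I} I"
    using ex_bij_betw_nat_finite[OF assms(2)] by (auto simp: atLeast0LessThan)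
  define K where "K = {..<card I}"
  have eI: "e k \<in> I" if "k \<in> K" for k
    using e that by (auto simp: bij_betw_def K_def)
  \<comment> \<open>Coordinates outside \<open>K\<close> are filled with 0 to give points of
    \<open>nat \<Rightarrow> complex\<close>. Under the image measure \<open>D\<close> the
    coordinate functions \<open>h k\<close> have the joint distribution of the enumerated
    functions.\<close>
  define \<Phi> where "\<Phi> x k = (if k \<in> K then f (e k) x else 0)" for x k
  define B :: "(nat \<Rightarrow> complex) measure" where "B = Pi\<^sub>M UNIV (\<lambda>_. borel)"
  define D where "D = distr M B \<Phi>"
  define h :: "nat \<Rightarrow> (nat \<Rightarrow> complex) \<Rightarrow> complex" where "h k y = y k" for k y
  have fm: "f n \<in> borel_measurable M" and fp: "integrable M (\<lambda>x. cmod (f n x) ^ (2*r))"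
    if "n \<in> I" for n
    using assms(3)[OF that] by (simp_all add: Lp_space_even_iff[OF r])
  have \<Phi>: "\<Phi> \<in> measurable M B"
    unfolding B_def
  proof (rule measurable_PiM_single')
    show "(\<lambda>x. \<Phi> x k) \<in> borel_measurable M" for k
      using fm[OF eI] by (cases "k \<in> K") (auto simp: \<Phi>_def)
  qed auto
  have hB [measurable]: "h k \<in> borel_measurable B" for k
    unfolding B_def h_def by measurable
  have h\<Phi>: "h k (\<Phi> x) = f (e k) x" if "k \<in> K" for k x
    using that by (simp add: h_def \<Phi>_def)
  have sum_h: "(\<Sum>k\<in>K. h k (\<Phi> x)) = (\<Sum>n\<in>I. f n x)" for x
    using sum.reindex_bij_betw[OF e, of "\<lambda>n. f n x"] by (simp add: h\<Phi> flip: K_def)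
  have sq_h: "square_function K h (\<Phi> x) = square_function I f x" for x
    using sum.reindex_bij_betw[OF e, of "\<lambda>n. (cmod (f n x))\<^sup>2"]
    by (simp add: square_function_def h\<Phi> flip: K_def)
  have "Lp_norm (2 * real r) D (\<lambda>y. \<Sum>k\<in>K. h k y)
      \<le> square_function_const r * Lp_norm (2 * real r) D (square_function K h)"
  proof (rule square_function_const[OF r])
    show "finite K" by (simp add: K_def)
    show "h k \<in> Lp_space (2 * real r) D" if "k \<in> K" for k
      using fp[OF eI[OF that]] that unfolding Lp_space_even_iff[OF r] D_def
      by (simp add: integrable_distr_eq[OF \<Phi>] h\<Phi>)
    show "type_II r D K h"
      unfolding type_II_def
    proof (intro ballI impI)
      fix n assume n: "n \<in> {1..2*r} \<rightarrow>\<^sub>E K" and "\<exists>v. appears_once (2*r) n v"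
      then obtain v where v: "appears_once (2*r) n v" by blast
      define n' where "n' = (\<lambda>j\<in>{1..2*r}. e (n j))"
      have n': "n' \<in> {1..2*r} \<rightarrow>\<^sub>E I" using n eI by (auto simp: n'_def)
      \<comment> \<open>The value \<open>v\<close> occurs in the tuple and hence lies in
        \<open>K\<close>, where \<open>e\<close> is injective; relabelling by \<open>e\<close>
        therefore preserves multiplicities.\<close>
      obtain j where "j \<in> {1..2*r}" "n j = v"
        using v unfolding appears_once_def by blast
      then have "v \<in> K" using n by blast
      have *: "n' j = e v \<longleftrightarrow> n j = v" if "j \<in> {1..2*r}" for j
      proof -
        have "n j \<in> K" using n that by auto
        then have "e (n j) = e v \<longleftrightarrow> n j = v"
          using e \<open>v \<in> K\<close> unfolding K_def bij_betw_def by (intro inj_on_eq_iff) auto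
        then show ?thesis using that by (simp add: n'_def)
      qed
      have "appears_once (2*r) n' (e v)"
        using v unfolding appears_once_def by (simp only: * cong: conj_cong)
      then have 0: "(\<integral>x. (\<Prod>j=1..r. f (n' (2*j - 1)) x * cnj (f (n' (2*j)) x)) \<partial>M) = 0"
        using assms(4) n' unfolding type_II_def by blast
      have "(\<integral>y. (\<Prod>j=1..r. h (n (2*j - 1)) y * cnj (h (n (2*j)) y)) \<partial>D)
          = (\<integral>x. (\<Prod>j=1..r. h (n (2*j - 1)) (\<Phi> x) * cnj (h (n (2*j)) (\<Phi> x))) \<partial>M)"
        unfolding D_def by (rule integral_distr[OF \<Phi>]) measurable
      also have "\<dots> = (\<integral>x. (\<Prod>j=1..r. f (n' (2*j - 1)) x * cnj (f (n' (2*j)) x)) \<partial>M)"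
      proof (intro Bochner_Integration.integral_cong prod.cong refl)
        fix x j assume j: "j \<in> {1..r}"
        then have *: "2*j - 1 \<in> {1..2*r}" "2*j \<in> {1..2*r}" by auto
        then have "n (2*j - 1) \<in> K" "n (2*j) \<in> K" using n by blast+
        then show "h (n (2*j - 1)) (\<Phi> x) * cnj (h (n (2*j)) (\<Phi> x))
            = f (n' (2*j - 1)) x * cnj (f (n' (2*j)) x)"
          using * by (simp add: h\<Phi> n'_def)
      qed
      finally show "(\<integral>y. (\<Prod>j=1..r. h (n (2*j - 1)) y * cnj (h (n (2*j)) y)) \<partial>D) = 0"
        using 0 by simp
    qed
  qed
  moreover have "Lp_norm (2 * real r) D (\<lambda>y. \<Sum>k\<in>K. h k y) = Lp_norm (2 * real r) M (\<lambda>x. \<Sum>n\<in>I. f n x)"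
    unfolding Lp_norm_even[OF r] D_def by (subst integral_distr[OF \<Phi>]) (simp_all add: sum_h)
  moreover have "Lp_norm (2 * real r) D (square_function K h) = Lp_norm (2 * real r) M (square_function I f)"
  proof -
    \<comment> \<open>The change of variables needs measurability on the target space
      \<open>B\<close>.\<close>
    have "(\<lambda>y. norm (square_function K h y) ^ (2*r)) \<in> borel_measurable B"
      unfolding square_function_def by measurable
    from integral_distr[OF \<Phi> this] show ?thesis
      unfolding Lp_norm_even[OF r] D_def by (simp add: sq_h)
  qed
  ultimately show ?thesis by simp
qed

end
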